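(* Let $p$ be a prime, let $M$ be a loopless and coloopless $p$-matroid on the ground set $E$, represented over $GF(p)$ by a matrix $A$, and let $T\subset E$. Let $M_T$ be the splitting matroid and $M'_T$ the element splitting matroid (with new element $z$) obtained from $M$ via $A$. Then 1. $\mathcal{C}(M_T)=\mathcal{C}_0\cup\mathcal{C}_1\cup\mathcal{C}_2$; 2. $\mathcal{C}(M'_T)=\mathcal{C}_0\cup\mathcal{C}_1\cup\mathcal{C}_2\cup\mathcal{C}_z$, where - $\mathcal{C}_0=\{C\in\mathcal{C}(M) : C \text{ is a } PT\text{-circuit or } C\cap T=\emptyset\}$; - $\mathcal{C}_1$ is the set of (inclusion-)minimal elements of $\{C\cup I : C\cup I \text{ is a } PT\text{-dependent set of } M\}$; - $\mathcal{C}_2$ is the set of minimal elements of $\{C_1\cup C_2 : C_1,C_2 \text{ are } NPT\text{-circuits of } M,\ C_1\cap C_2=\emptyset, \text{ and } C_1\cup C_2 \text{ contains no member of } \mathcal{C}_0 \text{ and no member of } \mathcal{C}_1\}$; - $\mathcal{C}_z=\{C\cup\{z\} : C \text{ is an } NPT\text{-circuit of } M\}$.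
   Context: A $p$-matroid is a matroid representable over the prime field $GF(p)$. $\mathcal{C}(N)$ denotes the collection of circuits of a matroid $N$. Fix a matrix $A$ over $GF(p)$ representing $M$, with columns labeled by $E$; elements of $E$ are identified with the corresponding columns of $A$ in linear relations. Let $A_T$ be the matrix obtained from $A$ by adjoining an extra row with entries zero everywhere except in the columns corresponding to members of $T$, where the entry is $1$. The splitting matroid $M_T$ is the vector matroid of $A_T$. Let $A'_T$ be the matrix obtained from $A_T$ by adjoining an extra column labeled $z$ with entries zero everywhere except in the last (newly added) row, where the entry is $1$. The element splitting matroid $M'_T$, on $E\cup\{z\}$, is the vector matroid of $A'_T$. Let $C$ be a circuit of $M$ with $C\cap T\neq\emptyset$. It is called a $PT$-circuit of $M$ if it is also a circuit of $M_T$, and an $NPT$-circuit of $M$ if it is not a circuit of $M_T$. $PT$-dependent set: consider subsets of $E$ of the form $C\cup I$, where $C=\{u_1,\dots,u_l\}$ is an $NPT$-circuit of $M$ disjoint from an independent set $I=\{v_1,\dots,v_k\}$ of $M$, and $T\cap(C\cup I)\neq\emptyset$. Such a $C\cup I$ is a $PT$-dependent set if it contains no member of $\mathcal{C}_0$ and there are non-zero constants $\alpha_1,\dots,\alpha_l,\beta_1,\dots,\beta_k\in GF(p)$ such that $\sum_{i=1}^{l}\alpha_iu_i+\sum_{j=1}^{k}\beta_jv_j=0$ and the sum of the coefficients (in this relation) of the elements of $T\cap(C\cup I)$ is $0$ modulo $p$. *)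

theory Defs
  imports "Berlekamp_Zassenhaus.Finite_Field" "Jordan_Normal_Form.Matrix"
begin

section \<open>Matroids\<close>

record 'e indep_system =
  ground :: "'e set"
  indeps :: "'e set set"

locale matroid =
  fixes M :: "'e indep_system"
  assumes finite_ground: "finite (ground M)"
    and indeps_subset: "X \<in> indeps M \<Longrightarrow> X \<subseteq> ground M"
    and indeps_empty: "{} \<in> indeps M"
    and indeps_mono: "\<lbrakk>Y \<in> indeps M; X \<subseteq> Y\<rbrakk> \<Longrightarrow> X \<in> indeps M"
    and augment: "\<lbrakk>X \<in> indeps M; Y \<in> indeps M; card X < card Y\<rbrakk>
                    \<Longrightarrow> \<exists>e \<in> Y - X. insert e X \<in> indeps M"

definition minimal_sets :: "'e set set \<Rightarrow> 'e set set" where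
  "minimal_sets F = {X \<in> F. \<forall>Y \<in> F. Y \<subseteq> X \<longrightarrow> Y = X}"

definition circuits :: "'e indep_system \<Rightarrow> 'e set set" where
  "circuits M = minimal_sets {X. X \<subseteq> ground M \<and> X \<notin> indeps M}"

definition bases :: "'e indep_system \<Rightarrow> 'e set set" where
  "bases M = {B \<in> indeps M. \<forall>Y \<in> indeps M. B \<subseteq> Y \<longrightarrow> Y = B}"

definition loop :: "'e indep_system \<Rightarrow> 'e \<Rightarrow> bool" where
  "loop M e \<longleftrightarrow> {e} \<in> circuits M"

definition coloop :: "'e indep_system \<Rightarrow> 'e \<Rightarrow> bool" where
  "coloop M e \<longleftrightarrow> e \<in> ground M \<and> (\<forall>B \<in> bases M. e \<in> B)"

section \<open>Vector matroids of matrices with labelled columns\<close>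

text \<open>A matrix with \<open>n\<close> rows whose columns are labelled by a set \<open>E\<close> is given by the
  family \<open>A\<close> of its columns, \<open>A e \<in> carrier_vec n\<close> for \<open>e \<in> E\<close>. Distinct labels may carry
  equal columns, so linear relations are relations of the family and not of the set of columns.\<close>

definition lin_relation :: "nat \<Rightarrow> ('e \<Rightarrow> 'k::field vec) \<Rightarrow> 'e set \<Rightarrow> ('e \<Rightarrow> 'k) \<Rightarrow> bool" where
  "lin_relation n A X c \<longleftrightarrow> finsum_vec TYPE('k) n (\<lambda>e. c e \<cdot>\<^sub>v A e) X = 0\<^sub>v n"

definition vector_matroid :: "nat \<Rightarrow> ('e \<Rightarrow> 'k::field vec) \<Rightarrow> 'e set \<Rightarrow> 'e indep_system" where
  "vector_matroid n A E =
     \<lparr> ground = E,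
       indeps = {X. X \<subseteq> E \<and> (\<forall>c. lin_relation n A X c \<longrightarrow> (\<forall>e \<in> X. c e = 0))} \<rparr>"

definition represents :: "nat \<Rightarrow> ('e \<Rightarrow> 'k::field vec) \<Rightarrow> 'e indep_system \<Rightarrow> bool" where
  "represents n A M \<longleftrightarrow>
     (\<forall>e \<in> ground M. A e \<in> carrier_vec n) \<and> M = vector_matroid n A (ground M)"

section \<open>Splitting and element splitting\<close>

text \<open>The new row is adjoined at the bottom, so it has index \<open>n\<close>.\<close>

definition split_matrix :: "('e \<Rightarrow> 'k::field vec) \<Rightarrow> 'e set \<Rightarrow> 'e \<Rightarrow> 'k vec" where
  "split_matrix A T e = A e @\<^sub>v vec 1 (\<lambda>_. if e \<in> T then 1 else 0)"

definition element_split_matrix ::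
    "nat \<Rightarrow> ('e \<Rightarrow> 'k::field vec) \<Rightarrow> 'e set \<Rightarrow> 'e \<Rightarrow> 'e \<Rightarrow> 'k vec" where
  "element_split_matrix n A T z = (split_matrix A T)(z := unit_vec (Suc n) n)"

definition splitting_matroid ::
    "nat \<Rightarrow> ('e \<Rightarrow> 'k::field vec) \<Rightarrow> 'e set \<Rightarrow> 'e set \<Rightarrow> 'e indep_system" where
  "splitting_matroid n A E T = vector_matroid (Suc n) (split_matrix A T) E"

definition element_splitting_matroid ::
    "nat \<Rightarrow> ('e \<Rightarrow> 'k::field vec) \<Rightarrow> 'e set \<Rightarrow> 'e set \<Rightarrow> 'e \<Rightarrow> 'e indep_system" where
  "element_splitting_matroid n A E T z =
     vector_matroid (Suc n) (element_split_matrix n A T z) (insert z E)"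

section \<open>The circuit families\<close>

definition PT_circuit ::
    "'e indep_system \<Rightarrow> nat \<Rightarrow> ('e \<Rightarrow> 'k::field vec) \<Rightarrow> 'e set \<Rightarrow> 'e set \<Rightarrow> bool" where
  "PT_circuit M n A T C \<longleftrightarrow>
     C \<in> circuits M \<and> C \<inter> T \<noteq> {} \<and> C \<in> circuits (splitting_matroid n A (ground M) T)"

definition NPT_circuit ::
    "'e indep_system \<Rightarrow> nat \<Rightarrow> ('e \<Rightarrow> 'k::field vec) \<Rightarrow> 'e set \<Rightarrow> 'e set \<Rightarrow> bool" where
  "NPT_circuit M n A T C \<longleftrightarrow>
     C \<in> circuits M \<and> C \<inter> T \<noteq> {} \<and> C \<notin> circuits (splitting_matroid n A (ground M) T)"

definition C0_family ::
    "'e indep_system \<Rightarrow> nat \<Rightarrow> ('e \<Rightarrow> 'k::field vec) \<Rightarrow> 'e set \<Rightarrow> 'e set set" where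
  "C0_family M n A T = {C \<in> circuits M. PT_circuit M n A T C \<or> C \<inter> T = {}}"

text \<open>Since \<open>C\<close> and \<open>I\<close> are disjoint, the two lists of coefficients are combined into one
  function \<open>a\<close> on \<open>C \<union> I\<close>.\<close>

definition PT_dependent ::
    "'e indep_system \<Rightarrow> nat \<Rightarrow> ('e \<Rightarrow> 'k::field vec) \<Rightarrow> 'e set \<Rightarrow> 'e set \<Rightarrow> bool" where
  "PT_dependent M n A T X \<longleftrightarrow>
     (\<exists>C I. X = C \<union> I \<and> NPT_circuit M n A T C \<and> I \<in> indeps M \<and> C \<inter> I = {}
        \<and> T \<inter> (C \<union> I) \<noteq> {}
        \<and> (\<forall>D \<in> C0_family M n A T. \<not> D \<subseteq> C \<union> I)
        \<and> (\<exists>a. (\<forall>e \<in> C \<union> I. a e \<noteq> 0) \<and> lin_relation n A (C \<union> I) a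
               \<and> (\<Sum>e \<in> T \<inter> (C \<union> I). a e) = 0))"

definition C1_family ::
    "'e indep_system \<Rightarrow> nat \<Rightarrow> ('e \<Rightarrow> 'k::field vec) \<Rightarrow> 'e set \<Rightarrow> 'e set set" where
  "C1_family M n A T = minimal_sets {X. PT_dependent M n A T X}"

definition C2_family ::
    "'e indep_system \<Rightarrow> nat \<Rightarrow> ('e \<Rightarrow> 'k::field vec) \<Rightarrow> 'e set \<Rightarrow> 'e set set" where
  "C2_family M n A T = minimal_sets
     {C1 \<union> C2 | C1 C2. NPT_circuit M n A T C1 \<and> NPT_circuit M n A T C2 \<and> C1 \<inter> C2 = {}
        \<and> (\<forall>D \<in> C0_family M n A T. \<not> D \<subseteq> C1 \<union> C2)
        \<and> (\<forall>D \<in> C1_family M n A T. \<not> D \<subseteq> C1 \<union> C2)}"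

definition Cz_family ::
    "'e indep_system \<Rightarrow> nat \<Rightarrow> ('e \<Rightarrow> 'k::field vec) \<Rightarrow> 'e set \<Rightarrow> 'e \<Rightarrow> 'e set set" where
  "Cz_family M n A T z = {C \<union> {z} | C. NPT_circuit M n A T C}"

section \<open>Vector matroids are matroids\<close>

lemma lin_relation_iff:
  fixes A :: "'e \<Rightarrow> 'k::field vec"
  assumes "finite X" "\<forall>e \<in> X. A e \<in> carrier_vec n"
  shows "lin_relation n A X c \<longleftrightarrow> (\<forall>i < n. (\<Sum>e \<in> X. c e * A e $ i) = 0)"
proof -
  have cl: "(\<lambda>e. c e \<cdot>\<^sub>v A e) \<in> X \<rightarrow> carrier_vec n"
    using assms by auto
  have dim: "finsum_vec TYPE('k) n (\<lambda>e. c e \<cdot>\<^sub>v A e) X \<in> carrier_vec n"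
    using finsum_vec_closed[OF cl] .
  have idx: "finsum_vec TYPE('k) n (\<lambda>e. c e \<cdot>\<^sub>v A e) X $ i = (\<Sum>e \<in> X. c e * A e $ i)"
    if "i < n" for i
  proof -
    have "finsum_vec TYPE('k) n (\<lambda>e. c e \<cdot>\<^sub>v A e) X $ i = (\<Sum>e \<in> X. (c e \<cdot>\<^sub>v A e) $ i)"
      using index_finsum_vec[OF assms(1) that cl] .
    also have "\<dots> = (\<Sum>e \<in> X. c e * A e $ i)"
      using assms(2) that by (intro sum.cong refl index_smult_vec(1)) auto
    finally show ?thesis .
  qed
  show ?thesis
  proof
    assume "lin_relation n A X c"
    then have z: "finsum_vec TYPE('k) n (\<lambda>e. c e \<cdot>\<^sub>v A e) X = 0\<^sub>v n"
      by (simp only: lin_relation_def)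
    show "\<forall>i < n. (\<Sum>e \<in> X. c e * A e $ i) = 0"
      by (intro allI impI, subst idx[symmetric], assumption, subst z, rule index_zero_vec(1))
  next
    assume rel: "\<forall>i < n. (\<Sum>e \<in> X. c e * A e $ i) = 0"
    have "finsum_vec TYPE('k) n (\<lambda>e. c e \<cdot>\<^sub>v A e) X = 0\<^sub>v n"
    proof (rule eq_vecI)
      fix i assume "i < dim_vec (0\<^sub>v n :: 'k vec)"
      then have i: "i < n" by simp
      show "finsum_vec TYPE('k) n (\<lambda>e. c e \<cdot>\<^sub>v A e) X $ i = 0\<^sub>v n $ i"
        by (subst idx[OF i], subst index_zero_vec(1)[OF i]) (use rel i in blast)
    qed (subst carrier_vecD[OF dim], rule index_zero_vec(2)[symmetric])
    then show "lin_relation n A X c" by (simp only: lin_relation_def)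
  qed
qed

lemma homogeneous_system_nontrivial:
  fixes b :: "'x \<Rightarrow> 'y \<Rightarrow> 'k::field"
  assumes "finite X" "finite Y" "card X < card Y"
  shows "\<exists>c. (\<exists>y \<in> Y. c y \<noteq> 0) \<and> (\<forall>x \<in> X. (\<Sum>y \<in> Y. c y * b x y) = 0)"
  using assms
proof (induction X arbitrary: Y b rule: finite_induct)
  case empty
  then show ?case by (intro exI[of _ "\<lambda>_. 1"]) (auto simp: card_gt_0_iff)
next
  case (insert x0 X)
  show ?case
  proof (cases "\<forall>y \<in> Y. b x0 y = 0")
    case True
    have "card X < card Y" using insert by simp
    from insert.IH[OF insert.prems(1) this, of b]
    obtain c where "\<exists>y \<in> Y. c y \<noteq> 0" "\<forall>x \<in> X. (\<Sum>y \<in> Y. c y * b x y) = 0"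
      by blast
    with True show ?thesis by (intro exI[of _ c]) simp
  next
    case False
    then obtain y0 where y0: "y0 \<in> Y" "b x0 y0 \<noteq> 0" by blast
    let ?Y = "Y - {y0}"
    have "card X < card ?Y" using insert y0 by simp
    from insert.IH[OF _ this, of "\<lambda>x y. b x y - b x y0 * b x0 y / b x0 y0"] insert.prems(1)
    obtain c where c: "\<exists>y \<in> ?Y. c y \<noteq> 0"
      and rel: "\<And>x. x \<in> X \<Longrightarrow> (\<Sum>y \<in> ?Y. c y * (b x y - b x y0 * b x0 y / b x0 y0)) = 0"
      by auto
    define s where "s = (\<Sum>y \<in> ?Y. c y * b x0 y)"
    define c' where "c' = c(y0 := - s / b x0 y0)"
    have split: "(\<Sum>y \<in> Y. c' y * b x y) = - s / b x0 y0 * b x y0 + (\<Sum>y \<in> ?Y. c y * b x y)" for x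
      using sum.remove[OF insert.prems(1) y0(1), of "\<lambda>y. c' y * b x y"]
      by (simp add: c'_def)
    have "(\<Sum>y \<in> Y. c' y * b x y) = 0" if "x \<in> insert x0 X" for x
    proof (cases "x = x0")
      case True
      then show ?thesis using split[of x0] y0 by (simp add: s_def)
    next
      case False
      then have "0 = (\<Sum>y \<in> ?Y. c y * (b x y - b x y0 * b x0 y / b x0 y0))"
        using rel that by simp
      also have "\<dots> = (\<Sum>y \<in> ?Y. c y * b x y) - (\<Sum>y \<in> ?Y. b x y0 / b x0 y0 * (c y * b x0 y))"
        by (simp add: sum_subtractf[symmetric] algebra_simps)
      also have "\<dots> = (\<Sum>y \<in> ?Y. c y * b x y) - b x y0 / b x0 y0 * s"
        by (simp only: s_def sum_distrib_left)
      finally show ?thesis using split[of x] by (simp add: field_simps)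
    qed
    moreover have "\<exists>y \<in> Y. c' y \<noteq> 0" using c by (auto simp: c'_def)
    ultimately show ?thesis by blast
  qed
qed

lemma matroid_vector_matroid:
  fixes A :: "'e \<Rightarrow> 'k::field vec"
  assumes fin: "finite E" and A: "\<forall>e \<in> E. A e \<in> carrier_vec n"
  shows "matroid (vector_matroid n A E)"
proof -
  define ind where
    "ind X \<longleftrightarrow> X \<subseteq> E \<and> (\<forall>c. (\<forall>i < n. (\<Sum>e \<in> X. c e * A e $ i) = 0) \<longrightarrow> (\<forall>e \<in> X. c e = 0))"
    for X
  have lr: "lin_relation n A X c \<longleftrightarrow> (\<forall>i < n. (\<Sum>e \<in> X. c e * A e $ i) = 0)" if "X \<subseteq> E" for X c
    using that fin A by (intro lin_relation_iff) (auto intro: finite_subset)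
  have ind: "X \<in> indeps (vector_matroid n A E) \<longleftrightarrow> ind X" for X
    using lr by (auto simp: vector_matroid_def ind_def)
  have ind_sub: "X \<subseteq> E" if "ind X" for X
    using that unfolding ind_def by (rule conjunct1)
  have ind_zero: "c e = 0"
    if "ind X" and c: "\<And>i. i < n \<Longrightarrow> (\<Sum>e \<in> X. c e * A e $ i) = 0" and "e \<in> X" for X c e
  proof -
    have "(\<forall>i < n. (\<Sum>e \<in> X. c e * A e $ i) = 0) \<longrightarrow> (\<forall>e \<in> X. c e = 0)"
      using \<open>ind X\<close> unfolding ind_def by (elim conjE allE)
    with c \<open>e \<in> X\<close> show ?thesis by simp
  qed
  have mono: "ind X" if Y: "ind Y" and XY: "X \<subseteq> Y" for X Y
    unfolding ind_def
  proof (intro conjI allI impI)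
    show "X \<subseteq> E" using XY ind_sub[OF Y] by (rule subset_trans)
    fix c assume c: "\<forall>i < n. (\<Sum>e \<in> X. c e * A e $ i) = 0"
    have finY: "finite Y" using ind_sub[OF Y] fin by (rule finite_subset)
    define c' where "c' e = (if e \<in> X then c e else 0)" for e
    have "(\<Sum>e \<in> Y. c' e * A e $ i) = (\<Sum>e \<in> X. c e * A e $ i)" for i
      using finY XY by (intro sum.mono_neutral_cong_right) (auto simp: c'_def)
    then have "(\<Sum>e \<in> Y. c' e * A e $ i) = 0" if "i < n" for i
      using c that by simp
    from ind_zero[OF Y this] have "c' e = 0" if "e \<in> Y" for e
      using that by simp
    then have "c' e = 0" if "e \<in> X" for e
      using that XY by auto
    then show "\<forall>e \<in> X. c e = 0" by (simp add: c'_def)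
  qed
  have aug: "\<exists>e \<in> Y - X. ind (insert e X)" if X: "ind X" and Y: "ind Y" and card: "card X < card Y"
    for X Y
  proof (rule ccontr)
    assume neg: "\<not> ?thesis"
    have fX: "finite X" and fY: "finite Y" and XE: "X \<subseteq> E" and YE: "Y \<subseteq> E"
      using ind_sub[OF X] ind_sub[OF Y] finite_subset[OF _ fin] by simp_all
    have "\<exists>d. \<forall>i < n. A y $ i = (\<Sum>x \<in> X. d x * A x $ i)" if yY: "y \<in> Y" for y
    proof (cases "y \<in> X")
      case True
      have "A y $ i = (\<Sum>x \<in> X. (if x = y then 1 else 0) * A x $ i)" for i
      proof -
        have "(\<Sum>x \<in> X. (if x = y then 1 else 0) * A x $ i) = (\<Sum>x \<in> X. if x = y then A x $ i else 0)"
          by (intro sum.cong) auto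
        then show ?thesis using True fX by simp
      qed
      then show ?thesis by (intro exI[of _ "\<lambda>x. if x = y then 1 else 0"]) simp
    next
      case False
      with neg that have "\<not> ind (insert y X)" by blast
      then obtain c where c: "\<forall>i < n. (\<Sum>e \<in> insert y X. c e * A e $ i) = 0"
        and nz: "\<exists>e \<in> insert y X. c e \<noteq> 0"
        using yY XE YE by (auto simp: ind_def)
      have c': "c y * A y $ i + (\<Sum>e \<in> X. c e * A e $ i) = 0" if "i < n" for i
        using c that fX False by simp
      have cy: "c y \<noteq> 0"
      proof
        assume "c y = 0"
        with c' have "(\<Sum>e \<in> X. c e * A e $ i) = 0" if "i < n" for i
          using that by fastforce
        from ind_zero[OF X this] \<open>c y = 0\<close> nz show False by auto
      qed
      have "A y $ i = (\<Sum>x \<in> X. (- c x / c y) * A x $ i)" if "i < n" for i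
      proof -
        have "(\<Sum>x \<in> X. (- c x / c y) * A x $ i) = - (1 / c y) * (\<Sum>x \<in> X. c x * A x $ i)"
          by (simp add: sum_distrib_left sum_negf)
        also have "\<dots> = A y $ i"
          using c'[OF that] cy by (simp add: field_simps add_eq_0_iff)
        finally show ?thesis by simp
      qed
      then show ?thesis by (intro exI[of _ "\<lambda>x. - c x / c y"]) simp
    qed
    then have "\<forall>y \<in> Y. \<exists>d. \<forall>i < n. A y $ i = (\<Sum>x \<in> X. d x * A x $ i)" by simp
    from bchoice[OF this] obtain d where d: "\<And>y i. y \<in> Y \<Longrightarrow> i < n \<Longrightarrow> A y $ i = (\<Sum>x \<in> X. d y x * A x $ i)"
      by auto
    from homogeneous_system_nontrivial[OF fX fY card, of "\<lambda>x y. d y x"]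
    obtain c where nz: "\<exists>y \<in> Y. c y \<noteq> 0" and c: "\<And>x. x \<in> X \<Longrightarrow> (\<Sum>y \<in> Y. c y * d y x) = 0"
      by blast
    have "(\<Sum>y \<in> Y. c y * A y $ i) = 0" if "i < n" for i
    proof -
      have "(\<Sum>y \<in> Y. c y * A y $ i) = (\<Sum>y \<in> Y. \<Sum>x \<in> X. c y * d y x * A x $ i)"
        using d that by (intro sum.cong) (auto simp: sum_distrib_left mult.assoc)
      also have "\<dots> = (\<Sum>x \<in> X. (\<Sum>y \<in> Y. c y * d y x) * A x $ i)"
        by (subst sum.swap) (simp add: sum_distrib_right)
      also have "\<dots> = 0" using c by simp
      finally show ?thesis .
    qed
    from ind_zero[OF Y this] nz show False by auto
  qed
  show ?thesis
  proof
    show "finite (ground (vector_matroid n A E))"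
      using fin by (simp add: vector_matroid_def)
    show "{} \<in> indeps (vector_matroid n A E)"
      by (simp add: vector_matroid_def)
  next
    fix X assume "X \<in> indeps (vector_matroid n A E)"
    then show "X \<subseteq> ground (vector_matroid n A E)" by (simp add: vector_matroid_def)
  qed (use ind mono aug in auto)
qed

end

theory Submission
  imports Defs
begin

text \<open>
  A circuit of \<open>M\<^sub>T\<close> is a minimal support of a nonzero linear relation of the columns of
  \<open>A\<close> whose coefficients on \<open>T\<close> sum to zero. Three facts connect \<open>M\<close> and \<open>M\<^sub>T\<close>: sets that
  are independent in \<open>M\<close> stay independent; a circuit of \<open>M\<close> lies in \<open>\<C>\<^sub>0\<close> exactly if it is
  dependent in \<open>M\<^sub>T\<close>, and then it is a circuit of \<open>M\<^sub>T\<close>; and the union of any two distinct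
  circuits of \<open>M\<close> is dependent in \<open>M\<^sub>T\<close>, because the functional ``sum of the coefficients on
  \<open>T\<close>'' has a nontrivial kernel on the plane spanned by the two circuit relations
  (\<open>union_of_circuits_dependent_split\<close>).

  Let \<open>X\<close> be a circuit of \<open>M\<^sub>T\<close> outside \<open>\<C>\<^sub>0\<close>. It properly contains a circuit \<open>C\<close> of \<open>M\<close>, and
  all circuits of \<open>M\<close> inside \<open>X\<close> are \<open>NPT\<close>-circuits. If \<open>X - C\<close> is independent in \<open>M\<close>, then
  \<open>X = C \<union> (X - C)\<close> is \<open>PT\<close>-dependent; otherwise \<open>X - C\<close> contains a circuit \<open>D\<close> of \<open>M\<close>, and
  \<open>C \<union> D\<close>, being dependent in \<open>M\<^sub>T\<close>, is all of \<open>X\<close>. Since every set considered in \<open>\<C>\<^sub>1\<close> and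
  \<open>\<C>\<^sub>2\<close> is dependent in \<open>M\<^sub>T\<close>, the circuit \<open>X\<close> is minimal in the relevant family.

  For the converse the delicate case is a member \<open>X = C \<union> I\<close> of \<open>\<C>\<^sub>1\<close>, which might properly
  contain a circuit \<open>D\<^sub>1 \<union> D\<^sub>2\<close> of \<open>M\<^sub>T\<close> from \<open>\<C>\<^sub>2\<close>. As \<open>I\<close> is independent, \<open>C\<close> meets both
  \<open>D\<^sub>1\<close> and \<open>D\<^sub>2\<close>, so \<open>X\<close> contains two distinct circuits of \<open>M\<close> that meet. A pair of such
  circuits with smallest union contains in its union a circuit of \<open>M\<^sub>T\<close> which is not a disjoint
  union of two circuits of \<open>M\<close> (\<open>minimal_meeting_circuits\<close>), hence lies in \<open>\<C>\<^sub>1\<close>, hence is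
  \<open>X\<close> by minimality of \<open>X\<close>; this contradicts that \<open>D\<^sub>1 \<union> D\<^sub>2\<close> is a proper subset of \<open>X\<close>.

  Deleting \<open>z\<close> from \<open>M'\<^sub>T\<close> gives \<open>M\<^sub>T\<close>, and contracting \<open>z\<close> gives \<open>M\<close>. So the circuits of
  \<open>M'\<^sub>T\<close> avoiding \<open>z\<close> are those of \<open>M\<^sub>T\<close>, and those through \<open>z\<close> are the sets \<open>C \<union> {z}\<close> with
  \<open>C\<close> a circuit of \<open>M\<close> that is independent in \<open>M\<^sub>T\<close>, that is, an \<open>NPT\<close>-circuit.
\<close>

section \<open>Circuits of independence systems\<close>

lemma circuits_iff:
  "C \<in> circuits N \<longleftrightarrow>
     C \<subseteq> ground N \<and> C \<notin> indeps N \<and> (\<forall>Y. Y \<subset> C \<longrightarrow> Y \<in> indeps N)"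
  unfolding circuits_def minimal_sets_def by blast

lemma circuit_minimal_dependent:
  assumes "C \<in> circuits N" "D \<subseteq> C" "D \<notin> indeps N"
  shows "D = C"
proof (rule ccontr)
  assume "D \<noteq> C"
  with assms(2) have "D \<subset> C" by blast
  with assms(1,3) show False by (simp add: circuits_iff)
qed

lemma circuit_subset_circuit_eq:
  assumes "C \<in> circuits N" "D \<in> circuits N" "D \<subseteq> C"
  shows "D = C"
proof (rule circuit_minimal_dependent[OF assms(1,3)])
  show "D \<notin> indeps N" using assms(2) by (simp add: circuits_iff)
qed

lemma finite_has_minimal_subset:
  assumes "finite X" "P X"
  shows "\<exists>Y \<subseteq> X. P Y \<and> (\<forall>Z. Z \<subset> Y \<longrightarrow> \<not> P Z)"
  using assms
proof (induction X rule: finite_psubset_induct)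
  case (psubset X)
  show ?case
  proof (cases "\<exists>Z. Z \<subset> X \<and> P Z")
    case True
    then obtain Z where "Z \<subset> X" "P Z" by blast
    with psubset.IH obtain Y where "Y \<subseteq> Z" "P Y \<and> (\<forall>Z. Z \<subset> Y \<longrightarrow> \<not> P Z)"
      by meson
    with \<open>Z \<subset> X\<close> show ?thesis by (meson psubset_imp_subset subset_trans)
  next
    case False
    with psubset.prems show ?thesis by (intro exI[of _ X]) simp
  qed
qed

lemma dependent_contains_circuit:
  assumes "finite X" "X \<subseteq> ground N" "X \<notin> indeps N"
  shows "\<exists>C \<in> circuits N. C \<subseteq> X"
proof -
  obtain Y where Y: "Y \<subseteq> X" "Y \<notin> indeps N" "\<And>Z. Z \<subset> Y \<Longrightarrow> Z \<in> indeps N"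
    using finite_has_minimal_subset[of X "\<lambda>Y. Y \<notin> indeps N", OF assms(1,3)] by auto
  then have "Y \<in> circuits N" using assms(2) unfolding circuits_iff by blast
  with Y(1) show ?thesis by blast
qed

section \<open>Linear relations\<close>

lemma ground_vector_matroid [simp]: "ground (vector_matroid n A E) = E"
  by (simp add: vector_matroid_def)

lemma dependent_vector_matroid_iff:
  assumes "X \<subseteq> E"
  shows "X \<notin> indeps (vector_matroid n A E) \<longleftrightarrow>
           (\<exists>c. lin_relation n A X c \<and> (\<exists>e \<in> X. c e \<noteq> 0))"
  using assms by (auto simp: vector_matroid_def)

lemma lin_relation_extend_zero:
  fixes A :: "'e \<Rightarrow> 'k::field vec"
  assumes "finite Y" "\<forall>e \<in> Y. A e \<in> carrier_vec n" "X \<subseteq> Y" "\<forall>e \<in> Y - X. c e = 0"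
  shows "lin_relation n A X c \<longleftrightarrow> lin_relation n A Y c"
proof -
  have "(\<Sum>e \<in> X. c e * A e $ i) = (\<Sum>e \<in> Y. c e * A e $ i)" for i
    using assms by (intro sum.mono_neutral_left) auto
  moreover have "finite X" using assms finite_subset by blast
  ultimately show ?thesis
    using lin_relation_iff[of X A n c] lin_relation_iff[of Y A n c] assms by auto
qed

lemma lin_relation_scaled_diff:
  fixes A :: "'e \<Rightarrow> 'k::field vec"
  assumes "finite X" "\<forall>e \<in> X. A e \<in> carrier_vec n"
    and "lin_relation n A X c" "lin_relation n A X d"
  shows "lin_relation n A X (\<lambda>e. r * c e - s * d e)"
proof -
  have "(\<Sum>e \<in> X. (r * c e - s * d e) * A e $ i)
          = r * (\<Sum>e \<in> X. c e * A e $ i) - s * (\<Sum>e \<in> X. d e * A e $ i)" for i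
    by (simp add: left_diff_distrib sum_subtractf sum_distrib_left mult.assoc)
  with assms show ?thesis by (simp add: lin_relation_iff)
qed

text \<open>The support of a nonzero relation on a circuit is dependent, so it is the whole circuit.\<close>

lemma circuit_full_support:
  fixes A :: "'e \<Rightarrow> 'k::field vec"
  assumes "finite E" "\<forall>e \<in> E. A e \<in> carrier_vec n"
    and C: "C \<in> circuits (vector_matroid n A E)"
  obtains c where "lin_relation n A C c" "\<forall>e \<in> C. c e \<noteq> 0"
proof -
  have CE: "C \<subseteq> E" and dep: "C \<notin> indeps (vector_matroid n A E)"
    using C by (auto simp: circuits_iff)
  then obtain c where c: "lin_relation n A C c" "\<exists>e \<in> C. c e \<noteq> 0"
    unfolding dependent_vector_matroid_iff[OF CE] by blast
  define S where "S = {e \<in> C. c e \<noteq> 0}"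
  have "finite C" using CE assms(1) finite_subset by blast
  have SC: "S \<subseteq> C" and "\<exists>e \<in> S. c e \<noteq> 0" using c(2) by (auto simp: S_def)
  have "lin_relation n A S c \<longleftrightarrow> lin_relation n A C c"
    by (rule lin_relation_extend_zero)
      (use \<open>finite C\<close> CE assms(2) in \<open>auto simp: S_def\<close>)
  with c(1) have "lin_relation n A S c" by blast
  with \<open>\<exists>e \<in> S. c e \<noteq> 0\<close> have "S \<notin> indeps (vector_matroid n A E)"
    unfolding dependent_vector_matroid_iff[OF subset_trans[OF SC CE]] by blast
  then have "S = C" using circuit_minimal_dependent[OF C SC] by blast
  then have "\<forall>e \<in> C. c e \<noteq> 0" unfolding S_def by blast
  with c(1) that show ?thesis by blast
qed

lemma split_matrix_carrier:
  "A e \<in> carrier_vec n \<Longrightarrow> split_matrix A T e \<in> carrier_vec (Suc n)"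
  by (rule carrier_vecI) (simp add: split_matrix_def)

lemma lin_relation_split_matrix:
  fixes A :: "'e \<Rightarrow> 'k::field vec"
  assumes X: "finite X" "\<forall>e \<in> X. A e \<in> carrier_vec n"
  shows "lin_relation (Suc n) (split_matrix A T) X c \<longleftrightarrow>
           lin_relation n A X c \<and> (\<Sum>e \<in> T \<inter> X. c e) = 0"
proof -
  have top: "(\<Sum>e \<in> X. c e * split_matrix A T e $ i) = (\<Sum>e \<in> X. c e * A e $ i)"
    if "i < n" for i
    using that X(2) by (intro sum.cong) (auto simp: split_matrix_def)
  have "(\<Sum>e \<in> X. c e * split_matrix A T e $ n) = (\<Sum>e \<in> X. if e \<in> T then c e else 0)"
    using X(2) by (intro sum.cong) (auto simp: split_matrix_def)
  also have "\<dots> = (\<Sum>e \<in> T \<inter> X. c e)"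
    using sum.inter_restrict[OF X(1), of c T] by (simp add: Int_commute)
  finally have bottom: "(\<Sum>e \<in> X. c e * split_matrix A T e $ n) = (\<Sum>e \<in> T \<inter> X. c e)" .
  have "lin_relation (Suc n) (split_matrix A T) X c \<longleftrightarrow>
          (\<forall>i < Suc n. (\<Sum>e \<in> X. c e * split_matrix A T e $ i) = 0)"
    using X by (intro lin_relation_iff) (auto intro: split_matrix_carrier)
  also have "\<dots> \<longleftrightarrow> (\<forall>i < n. (\<Sum>e \<in> X. c e * A e $ i) = 0) \<and> (\<Sum>e \<in> T \<inter> X. c e) = 0"
    using top bottom by (auto simp: less_Suc_eq)
  finally show ?thesis using X by (simp add: lin_relation_iff)
qed

lemma element_split_matrix_carrier:
  "A e \<in> carrier_vec n \<or> e = z \<Longrightarrow> element_split_matrix n A T z e \<in> carrier_vec (Suc n)"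
  by (auto simp: element_split_matrix_def split_matrix_carrier)

lemma lin_relation_element_split_matrix:
  fixes A :: "'e \<Rightarrow> 'k::field vec"
  assumes X: "finite X" "\<forall>e \<in> X. A e \<in> carrier_vec n" "z \<notin> X"
  shows "lin_relation (Suc n) (element_split_matrix n A T z) X c \<longleftrightarrow>
           lin_relation n A X c \<and> (\<Sum>e \<in> T \<inter> X. c e) = 0" (is ?without)
    and "lin_relation (Suc n) (element_split_matrix n A T z) (insert z X) c \<longleftrightarrow>
           lin_relation n A X c \<and> (\<Sum>e \<in> T \<inter> X. c e) + c z = 0" (is ?with)
proof -
  let ?B = "element_split_matrix n A T z"
  have carrier: "\<forall>e \<in> insert z X. ?B e \<in> carrier_vec (Suc n)"
    using X by (auto intro: element_split_matrix_carrier)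
  have top: "(\<Sum>e \<in> X. c e * ?B e $ i) = (\<Sum>e \<in> X. c e * A e $ i)" if "i < n" for i
    using that X by (intro sum.cong) (auto simp: element_split_matrix_def split_matrix_def)
  have "(\<Sum>e \<in> X. c e * ?B e $ n) = (\<Sum>e \<in> X. if e \<in> T then c e else 0)"
    using X by (intro sum.cong) (auto simp: element_split_matrix_def split_matrix_def)
  also have "\<dots> = (\<Sum>e \<in> T \<inter> X. c e)"
    using sum.inter_restrict[OF X(1), of c T] by (simp add: Int_commute)
  finally have bottom: "(\<Sum>e \<in> X. c e * ?B e $ n) = (\<Sum>e \<in> T \<inter> X. c e)" .
  have z: "?B z $ i = (if i = n then 1 else 0)" if "i < Suc n" for i
    using that by (simp add: element_split_matrix_def)
  have "lin_relation (Suc n) ?B X c \<longleftrightarrow> (\<forall>i < Suc n. (\<Sum>e \<in> X. c e * ?B e $ i) = 0)"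
    using X carrier by (intro lin_relation_iff) auto
  also have "\<dots> \<longleftrightarrow> (\<forall>i < n. (\<Sum>e \<in> X. c e * A e $ i) = 0) \<and> (\<Sum>e \<in> T \<inter> X. c e) = 0"
    using top bottom by (auto simp: less_Suc_eq)
  finally show ?without using X by (simp add: lin_relation_iff)
  have "lin_relation (Suc n) ?B (insert z X) c \<longleftrightarrow>
          (\<forall>i < Suc n. (\<Sum>e \<in> insert z X. c e * ?B e $ i) = 0)"
    using X carrier by (intro lin_relation_iff) auto
  also have "\<dots> \<longleftrightarrow> (\<forall>i < Suc n. c z * ?B z $ i + (\<Sum>e \<in> X. c e * ?B e $ i) = 0)"
    using X by simp
  also have "\<dots> \<longleftrightarrow> (\<forall>i < n. (\<Sum>e \<in> X. c e * A e $ i) = 0)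
                     \<and> (\<Sum>e \<in> T \<inter> X. c e) + c z = 0"
    using top bottom z by (auto simp: less_Suc_eq add.commute)
  finally show ?with using X by (simp add: lin_relation_iff)
qed

section \<open>The splitting matroid\<close>

locale labelled_columns =
  fixes n :: nat and A :: "'e \<Rightarrow> 'k::field vec" and E T :: "'e set"
  assumes finite_E: "finite E"
    and columns: "\<forall>e \<in> E. A e \<in> carrier_vec n"
begin

abbreviation M where "M \<equiv> vector_matroid n A E"
abbreviation M\<^sub>T where "M\<^sub>T \<equiv> splitting_matroid n A E T"
abbreviation \<C>\<^sub>0 where "\<C>\<^sub>0 \<equiv> C0_family M n A T"
abbreviation \<C>\<^sub>1 where "\<C>\<^sub>1 \<equiv> C1_family M n A T"
abbreviation \<C>\<^sub>2 where "\<C>\<^sub>2 \<equiv> C2_family M n A T"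
abbreviation NPT where "NPT \<equiv> NPT_circuit M n A T"

lemma finite_subset_E: "X \<subseteq> E \<Longrightarrow> finite X"
  using finite_E finite_subset by blast

lemma columns_subset: "X \<subseteq> E \<Longrightarrow> \<forall>e \<in> X. A e \<in> carrier_vec n"
  using columns by blast

lemma split_columns: "\<forall>e \<in> E. split_matrix A T e \<in> carrier_vec (Suc n)"
  by (intro ballI split_matrix_carrier) (rule bspec[OF columns])

lemma ground_split [simp]: "ground M\<^sub>T = E"
  by (simp add: splitting_matroid_def)

lemma circuit_subset_E: "C \<in> circuits M \<Longrightarrow> C \<subseteq> E" "C \<in> circuits M\<^sub>T \<Longrightarrow> C \<subseteq> E"
  by (auto simp: circuits_iff)

lemma dependent_split_iff:
  assumes "X \<subseteq> E"
  shows "X \<notin> indeps M\<^sub>T \<longleftrightarrow>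
    (\<exists>c. lin_relation n A X c \<and> (\<Sum>e \<in> T \<inter> X. c e) = 0 \<and> (\<exists>e \<in> X. c e \<noteq> 0))"
  unfolding splitting_matroid_def dependent_vector_matroid_iff[OF assms]
  using lin_relation_split_matrix[OF finite_subset_E[OF assms] columns_subset[OF assms]]
  by auto

lemma dependent_split_imp_dependent:
  assumes "X \<subseteq> E" "X \<notin> indeps M\<^sub>T"
  shows "X \<notin> indeps M"
  using assms dependent_split_iff[of X] dependent_vector_matroid_iff[of X E n A] by blast

lemma dependent_split_mono:
  assumes "X \<subseteq> Y" "Y \<subseteq> E" "X \<notin> indeps M\<^sub>T"
  shows "Y \<notin> indeps M\<^sub>T"
proof -
  have "matroid M\<^sub>T"
    unfolding splitting_matroid_def
    using matroid_vector_matroid[OF finite_E split_columns] .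
  then show ?thesis using assms matroid.indeps_mono[of M\<^sub>T Y X] by blast
qed

lemma circuit_dependent_split_is_circuit:
  assumes "C \<in> circuits M" "C \<notin> indeps M\<^sub>T"
  shows "C \<in> circuits M\<^sub>T"
  unfolding circuits_iff
proof (intro conjI allI impI)
  show "C \<subseteq> ground M\<^sub>T" using circuit_subset_E assms by simp
  show "C \<notin> indeps M\<^sub>T" by fact
  fix Y assume "Y \<subset> C"
  then have "Y \<in> indeps M" "Y \<subseteq> E" using assms(1) by (auto simp: circuits_iff)
  then show "Y \<in> indeps M\<^sub>T" using dependent_split_imp_dependent by blast
qed

lemma circuit_avoiding_T_dependent_split:
  assumes "C \<in> circuits M" "C \<inter> T = {}"
  shows "C \<notin> indeps M\<^sub>T"
proof -
  have "T \<inter> C = {}" using assms(2) by blast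
  moreover have "C \<subseteq> E" "C \<notin> indeps M" using assms(1) by (auto simp: circuits_iff)
  ultimately show ?thesis
    using dependent_split_iff[of C] dependent_vector_matroid_iff[of C E n A] by auto
qed

lemma C0_family_iff: "C \<in> \<C>\<^sub>0 \<longleftrightarrow> C \<in> circuits M \<and> C \<in> circuits M\<^sub>T"
  unfolding C0_family_def PT_circuit_def
  using circuit_avoiding_T_dependent_split circuit_dependent_split_is_circuit by auto

lemma NPT_circuit_iff: "NPT C \<longleftrightarrow> C \<in> circuits M \<and> C \<in> indeps M\<^sub>T"
proof -
  have "C \<in> circuits M\<^sub>T \<Longrightarrow> C \<notin> indeps M\<^sub>T" by (simp add: circuits_iff)
  then show ?thesis
    unfolding NPT_circuit_def
    using circuit_avoiding_T_dependent_split circuit_dependent_split_is_circuit by auto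
qed

lemma circuit_cases:
  assumes "C \<in> circuits M"
  obtains "C \<in> \<C>\<^sub>0" | "NPT C"
  using assms C0_family_iff NPT_circuit_iff circuit_dependent_split_is_circuit by blast

text \<open>With circuit relations \<open>c\<close> and \<open>d\<close>, whose coefficients on \<open>T\<close> have sums \<open>t(c)\<close> and
  \<open>t(d)\<close>, the combination \<open>t(d) c - t(c) d\<close> has \<open>T\<close>-sum zero. It is nonzero on \<open>D - C\<close> when
  \<open>t(c) \<noteq> 0\<close>; when \<open>t(c) = 0\<close>, the relation \<open>c\<close> itself serves.\<close>

lemma union_of_circuits_dependent_split:
  assumes C: "C \<in> circuits M" and D: "D \<in> circuits M" and "C \<noteq> D"
  shows "C \<union> D \<notin> indeps M\<^sub>T"
proof -
  have sub: "C \<union> D \<subseteq> E" and CE: "C \<subseteq> E" using circuit_subset_E C D by auto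
  obtain c where c: "lin_relation n A C c" "\<forall>e \<in> C. c e \<noteq> 0"
    using circuit_full_support[OF finite_E columns C] .
  obtain d where d: "lin_relation n A D d" "\<forall>e \<in> D. d e \<noteq> 0"
    using circuit_full_support[OF finite_E columns D] .
  obtain y where y: "y \<in> D" "y \<notin> C"
    using circuit_subset_circuit_eq[OF C D] \<open>C \<noteq> D\<close> by blast
  obtain x where x: "x \<in> C" using circuit_subset_circuit_eq[OF D C] \<open>C \<noteq> D\<close> by blast
  let ?c = "\<lambda>e. if e \<in> C then c e else 0" and ?d = "\<lambda>e. if e \<in> D then d e else 0"
  let ?t = "\<lambda>c. \<Sum>e \<in> T \<inter> (C \<union> D). c e"
  have fin: "finite (C \<union> D)" "finite C" "finite D" using finite_subset_E sub by auto
  have "lin_relation n A C ?c"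
    using c(1) fin(2) columns_subset[of C] sub by (simp add: lin_relation_iff)
  then have c': "lin_relation n A (C \<union> D) ?c"
    by (rule lin_relation_extend_zero[THEN iffD1, rotated -1])
      (use fin(1) columns_subset[OF sub] in auto)
  have "lin_relation n A D ?d"
    using d(1) fin(3) columns_subset[of D] sub by (simp add: lin_relation_iff)
  then have d': "lin_relation n A (C \<union> D) ?d"
    by (rule lin_relation_extend_zero[THEN iffD1, rotated -1])
      (use fin(1) columns_subset[OF sub] in auto)
  show ?thesis
  proof (cases "?t ?c = 0")
    case True
    moreover have "?c x \<noteq> 0" using x c(2) by simp
    ultimately show ?thesis
      unfolding dependent_split_iff[OF sub] using c' x by (intro exI[of _ ?c]) blast
  next
    case False
    let ?s = "\<lambda>e. ?t ?d * ?c e - ?t ?c * ?d e"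
    have "lin_relation n A (C \<union> D) ?s"
      using lin_relation_scaled_diff[OF fin(1) columns_subset[OF sub] c' d'] .
    moreover have "?t ?s = ?t ?d * ?t ?c - ?t ?c * ?t ?d"
      by (simp only: sum_subtractf sum_distrib_left)
    then have "?t ?s = 0" by simp
    moreover have "?s y \<noteq> 0" using y d(2) False by simp
    ultimately show ?thesis
      unfolding dependent_split_iff[OF sub] using y(1) by (intro exI[of _ ?s]) blast
  qed
qed

lemma PT_dependent_dependent_split:
  assumes "PT_dependent M n A T X"
  shows "X \<subseteq> E" "X \<notin> indeps M\<^sub>T"
proof -
  obtain C I a where X: "X = C \<union> I" "NPT C" "I \<in> indeps M" "T \<inter> (C \<union> I) \<noteq> {}"
    and a: "\<forall>e \<in> C \<union> I. a e \<noteq> 0" "lin_relation n A (C \<union> I) a" "(\<Sum>e \<in> T \<inter> (C \<union> I). a e) = 0"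
    using assms unfolding PT_dependent_def by (elim exE conjE)
  have "C \<subseteq> E" using X(2) circuit_subset_E(1) NPT_circuit_iff by blast
  moreover have "I \<subseteq> E" using X(3) by (simp add: vector_matroid_def)
  ultimately show XE: "X \<subseteq> E" using X(1) by blast
  obtain e where "e \<in> X" using X(1,4) by blast
  then have "\<exists>e \<in> X. a e \<noteq> 0" using a(1) X(1) by blast
  with a(2,3) show "X \<notin> indeps M\<^sub>T"
    unfolding dependent_split_iff[OF XE] by (intro exI[of _ a]) (simp add: X(1))
qed

lemma C1_familyD:
  assumes "X \<in> \<C>\<^sub>1"
  shows "PT_dependent M n A T X" "PT_dependent M n A T Y \<Longrightarrow> Y \<subseteq> X \<Longrightarrow> Y = X"
  using assms by (auto simp: C1_family_def minimal_sets_def)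

lemma disjoint_NPT_union_dependent_split:
  assumes "NPT C" "NPT D" "C \<inter> D = {}"
  shows "C \<union> D \<subseteq> E" "C \<union> D \<notin> indeps M\<^sub>T"
proof -
  have "C \<in> circuits M" "D \<in> circuits M" using assms by (auto simp: NPT_circuit_iff)
  moreover have "C \<noteq> {}" using assms(1) by (auto simp: NPT_circuit_def)
  then have "C \<noteq> D" using assms(3) by blast
  ultimately show "C \<union> D \<subseteq> E" "C \<union> D \<notin> indeps M\<^sub>T"
    using circuit_subset_E union_of_circuits_dependent_split by auto
qed

definition disjoint_NPT_union :: "'e set \<Rightarrow> bool" where
  "disjoint_NPT_union X \<longleftrightarrow> (\<exists>C D. X = C \<union> D \<and> NPT C \<and> NPT D \<and> C \<inter> D = {})"

lemma C2_family_eq: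
  "\<C>\<^sub>2 = minimal_sets {X. disjoint_NPT_union X \<and> (\<forall>D \<in> \<C>\<^sub>0. \<not> D \<subseteq> X) \<and> (\<forall>D \<in> \<C>\<^sub>1. \<not> D \<subseteq> X)}"
  unfolding C2_family_def disjoint_NPT_union_def
  by (rule arg_cong[where f = minimal_sets]) blast

lemma disjoint_NPT_unionD:
  assumes "disjoint_NPT_union X"
  shows "X \<subseteq> E" "X \<notin> indeps M\<^sub>T"
  using assms disjoint_NPT_union_dependent_split unfolding disjoint_NPT_union_def by auto

text \<open>Whether the part of the circuit outside a chosen circuit \<open>C\<close> of \<open>M\<close> is independent
  decides between the last two alternatives. Full support of the relation on \<open>X\<close> provides the
  nonzero coefficients that \<open>PT\<close>-dependence asks for.\<close>

lemma split_circuit_cases: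
  assumes X: "X \<in> circuits M\<^sub>T"
  obtains "X \<in> \<C>\<^sub>0" | "PT_dependent M n A T X" | "disjoint_NPT_union X"
proof -
  have XE: "X \<subseteq> E" and dep: "X \<notin> indeps M\<^sub>T" using X by (auto simp: circuits_iff)
  have "X \<notin> indeps M" using dependent_split_imp_dependent[OF XE dep] .
  then obtain C where C: "C \<in> circuits M" "C \<subseteq> X"
    using dependent_contains_circuit[of X M] XE finite_subset_E by auto
  show ?thesis
  proof (cases "X \<in> \<C>\<^sub>0")
    case False
    have no0: "\<not> D \<subseteq> X" if "D \<in> \<C>\<^sub>0" for D
      using that False circuit_subset_circuit_eq[OF X] C0_family_iff by blast
    then have NPT: "NPT D" if "D \<in> circuits M" "D \<subseteq> X" for D
      using that circuit_cases by blast
    show ?thesis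
    proof (cases "X - C \<in> indeps M")
      case True
      obtain a where a: "lin_relation (Suc n) (split_matrix A T) X a" "\<forall>e \<in> X. a e \<noteq> 0"
        using circuit_full_support[OF finite_E split_columns X[unfolded splitting_matroid_def]] .
      then have "lin_relation n A X a \<and> (\<Sum>e \<in> T \<inter> X. a e) = 0"
        using lin_relation_split_matrix[OF finite_subset_E columns_subset] XE by blast
      moreover have "C \<union> (X - C) = X" using C by blast
      moreover have "T \<inter> X \<noteq> {}" using NPT[OF C] C(2) by (auto simp: NPT_circuit_def)
      ultimately have "PT_dependent M n A T X"
        unfolding PT_dependent_def
        using True NPT[OF C] no0 a(2) by (intro exI[of _ C] exI[of _ "X - C"]) auto
      with that show ?thesis by blast
    next
      case False
      then obtain D where D: "D \<in> circuits M" "D \<subseteq> X - C"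
        using dependent_contains_circuit[of "X - C" M] XE finite_subset_E[of "X - C"] by auto
      have N: "NPT C" "NPT D" "C \<inter> D = {}" using NPT C D by auto
      then have "C \<union> D = X"
        using disjoint_NPT_union_dependent_split[OF N] circuit_minimal_dependent[OF X] C D by blast
      with N that show ?thesis unfolding disjoint_NPT_union_def by blast
    qed
  qed (use that in blast)
qed

text \<open>All the candidate sets are dependent in \<open>M\<^sub>T\<close>, so a circuit of \<open>M\<^sub>T\<close> that is a candidate is
  automatically a minimal one.\<close>

lemma split_circuit_families:
  assumes X: "X \<in> circuits M\<^sub>T"
  shows "X \<in> \<C>\<^sub>0 \<union> \<C>\<^sub>1 \<union> \<C>\<^sub>2"
proof -
  have C1: "X \<in> \<C>\<^sub>1" if "PT_dependent M n A T X"
    using that PT_dependent_dependent_split circuit_minimal_dependent[OF X]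
    by (auto simp: C1_family_def minimal_sets_def)
  show ?thesis
    using X
  proof (cases rule: split_circuit_cases)
    case 3
    have "D = X" if "D \<in> \<C>\<^sub>0" "D \<subseteq> X" for D
      using that circuit_subset_circuit_eq[OF X] C0_family_iff by blast
    moreover have "D = X" if "D \<in> \<C>\<^sub>1" "D \<subseteq> X" for D
      using that C1_familyD(1) PT_dependent_dependent_split circuit_minimal_dependent[OF X] by blast
    moreover have "Y = X" if "disjoint_NPT_union Y" "Y \<subseteq> X" for Y
      using that disjoint_NPT_unionD circuit_minimal_dependent[OF X] by blast
    ultimately show ?thesis using 3 unfolding C2_family_eq minimal_sets_def by blast
  qed (use C1 in auto)
qed

text \<open>In a smallest union \<open>C \<union> D\<close> of two distinct meeting circuits, every further circuit meets both
  \<open>C - D\<close> and \<open>D - C\<close>, so by minimality it contains both differences. Hence no two circuits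
  inside the union are disjoint.\<close>

lemma minimal_meeting_circuits:
  assumes C: "C \<in> circuits M" and D: "D \<in> circuits M" and "C \<noteq> D" "C \<inter> D \<noteq> {}"
    and min: "\<And>F G. F \<in> circuits M \<Longrightarrow> G \<in> circuits M \<Longrightarrow> F \<noteq> G \<Longrightarrow> F \<inter> G \<noteq> {} \<Longrightarrow>
                F \<union> G \<subseteq> C \<union> D \<Longrightarrow> F \<union> G = C \<union> D"
    and F: "F \<in> circuits M" "F \<subseteq> C \<union> D" and G: "G \<in> circuits M" "G \<subseteq> C \<union> D" and "F \<noteq> G"
  shows "F \<inter> G \<noteq> {}"
proof -
  have CD: "C - D \<noteq> {}" "D - C \<noteq> {}"
    using circuit_subset_circuit_eq C D \<open>C \<noteq> D\<close> by blast+
  have other: "C - D \<subseteq> H \<and> H \<inter> C \<noteq> {} \<and> H \<inter> D \<noteq> {}"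
    if H: "H \<in> circuits M" "H \<subseteq> C \<union> D" "H \<noteq> C" "H \<noteq> D" for H
  proof -
    have "\<not> H \<subseteq> C" "\<not> H \<subseteq> D" using circuit_subset_circuit_eq C D H by blast+
    then have meets: "H \<inter> C \<noteq> {}" "H \<inter> D \<noteq> {}" using H(2) by blast+
    then have "H \<union> D = C \<union> D" using min[OF H(1) D] H by blast
    with meets show ?thesis by blast
  qed
  show ?thesis
  proof (cases "F \<in> {C, D} \<and> G \<in> {C, D}")
    case True
    with \<open>F \<noteq> G\<close> \<open>C \<inter> D \<noteq> {}\<close> show ?thesis by auto
  next
    case False
    then consider "F \<notin> {C, D}" "G \<notin> {C, D}" | "F \<notin> {C, D}" "G \<in> {C, D}"
      | "F \<in> {C, D}" "G \<notin> {C, D}" by blast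
    then show ?thesis
    proof cases
      case 1
      with other[OF F] other[OF G] CD show ?thesis by blast
    next
      case 2
      with other[OF F] show ?thesis by blast
    next
      case 3
      with other[OF G] show ?thesis by blast
    qed
  qed
qed

lemma meeting_circuits_contain_other_split_circuit:
  assumes C: "C \<in> circuits M" and D: "D \<in> circuits M" and "C \<noteq> D" "C \<inter> D \<noteq> {}"
  shows "\<exists>Y \<in> circuits M\<^sub>T. Y \<subseteq> C \<union> D \<and> \<not> disjoint_NPT_union Y"
proof -
  define meeting_union where "meeting_union U \<longleftrightarrow>
    (\<exists>F G. U = F \<union> G \<and> F \<in> circuits M \<and> G \<in> circuits M \<and> F \<noteq> G \<and> F \<inter> G \<noteq> {})" for U
  have "finite (C \<union> D)" using circuit_subset_E(1)[OF C] circuit_subset_E(1)[OF D] finite_subset_E by simp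
  moreover have "meeting_union (C \<union> D)" unfolding meeting_union_def using assms by blast
  ultimately obtain U where U: "U \<subseteq> C \<union> D" "meeting_union U" "\<And>V. V \<subset> U \<Longrightarrow> \<not> meeting_union V"
    using finite_has_minimal_subset[of "C \<union> D" meeting_union] by blast
  then obtain F G where FG: "U = F \<union> G" "F \<in> circuits M" "G \<in> circuits M" "F \<noteq> G" "F \<inter> G \<noteq> {}"
    unfolding meeting_union_def by blast
  have min: "F' \<union> G' = F \<union> G"
    if "F' \<in> circuits M" "G' \<in> circuits M" "F' \<noteq> G'" "F' \<inter> G' \<noteq> {}" "F' \<union> G' \<subseteq> F \<union> G" for F' G'
    using that U(3)[of "F' \<union> G'"] FG(1) unfolding meeting_union_def by blast
  have UE: "F \<union> G \<subseteq> E" using FG circuit_subset_E by blast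
  obtain Y where Y: "Y \<in> circuits M\<^sub>T" "Y \<subseteq> F \<union> G"
    using dependent_contains_circuit[of "F \<union> G" M\<^sub>T] union_of_circuits_dependent_split[OF FG(2-4)]
      UE finite_subset_E[OF UE] by auto
  have "\<not> disjoint_NPT_union Y"
  proof
    assume "disjoint_NPT_union Y"
    then obtain K L where KL: "Y = K \<union> L" "NPT K" "NPT L" "K \<inter> L = {}"
      unfolding disjoint_NPT_union_def by blast
    then have "K \<in> circuits M" "L \<in> circuits M" "K \<noteq> L"
      by (auto simp: NPT_circuit_iff NPT_circuit_def)
    with minimal_meeting_circuits[OF FG(2-5) min, of K L] KL Y(2) show False by blast
  qed
  with Y U(1) FG(1) show ?thesis by blast
qed

lemma C1_family_split_circuit:
  assumes X: "X \<in> \<C>\<^sub>1"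
  shows "X \<in> circuits M\<^sub>T"
proof (rule ccontr)
  assume not_circuit: "X \<notin> circuits M\<^sub>T"
  have PT: "PT_dependent M n A T X" using C1_familyD(1)[OF X] .
  then have XE: "X \<subseteq> E" and dep: "X \<notin> indeps M\<^sub>T"
    by (auto dest: PT_dependent_dependent_split)
  obtain C I where CI: "X = C \<union> I" "NPT C" "I \<in> indeps M" "C \<inter> I = {}"
    and "\<forall>D \<in> \<C>\<^sub>0. \<not> D \<subseteq> C \<union> I"
    using PT unfolding PT_dependent_def by (elim exE conjE)
  then have no0: "\<not> D \<subseteq> X" if "D \<in> \<C>\<^sub>0" for D using that by simp
  have type2: "disjoint_NPT_union Y" if Y: "Y \<in> circuits M\<^sub>T" "Y \<subseteq> X" for Y
    using Y(1)
  proof (cases rule: split_circuit_cases)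
    case 2
    with C1_familyD(2)[OF X] Y not_circuit show ?thesis by blast
  qed (use no0 Y(2) in auto)
  obtain Y where Y: "Y \<in> circuits M\<^sub>T" "Y \<subseteq> X"
    using dependent_contains_circuit[of X M\<^sub>T] XE dep finite_subset_E[OF XE] by auto
  from type2[OF Y] obtain D\<^sub>1 D\<^sub>2
    where D: "Y = D\<^sub>1 \<union> D\<^sub>2" "NPT D\<^sub>1" "NPT D\<^sub>2" "D\<^sub>1 \<inter> D\<^sub>2 = {}"
    unfolding disjoint_NPT_union_def by (elim exE conjE)
  have "matroid M" using matroid_vector_matroid finite_E columns .
  then have not_sub: "\<not> F \<subseteq> I" if "NPT F" for F
    using that CI(3) matroid.indeps_mono by (auto simp: NPT_circuit_iff circuits_iff)
  have "D\<^sub>1 \<inter> C \<noteq> {}" "D\<^sub>2 \<inter> C \<noteq> {}" using not_sub D Y(2) CI(1) by blast+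
  then have "D\<^sub>1 \<noteq> C" using D(4) by blast
  have "C \<in> circuits M" "D\<^sub>1 \<in> circuits M" using CI(2) D(2) by (auto simp: NPT_circuit_iff)
  then obtain Z where "Z \<in> circuits M\<^sub>T" "Z \<subseteq> D\<^sub>1 \<union> C" "\<not> disjoint_NPT_union Z"
    using meeting_circuits_contain_other_split_circuit \<open>D\<^sub>1 \<noteq> C\<close> \<open>D\<^sub>1 \<inter> C \<noteq> {}\<close> by blast
  with type2[of Z] D(1) Y(2) CI(1) show False by blast
qed

lemma C2_family_split_circuit:
  assumes "X \<in> \<C>\<^sub>2"
  shows "X \<in> circuits M\<^sub>T"
proof -
  have X: "disjoint_NPT_union X" "\<And>D. D \<in> \<C>\<^sub>0 \<Longrightarrow> \<not> D \<subseteq> X" "\<And>D. D \<in> \<C>\<^sub>1 \<Longrightarrow> \<not> D \<subseteq> X"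
    and min: "\<And>Y. Y \<in> \<C>\<^sub>2 \<Longrightarrow> Y \<subseteq> X \<Longrightarrow> Y = X"
    using assms by (auto simp: C2_family_eq minimal_sets_def)
  obtain Y where Y: "Y \<in> circuits M\<^sub>T" "Y \<subseteq> X"
    using dependent_contains_circuit[of X M\<^sub>T] disjoint_NPT_unionD[OF X(1)] finite_subset_E by auto
  then have "Y \<in> \<C>\<^sub>2" using split_circuit_families X by blast
  with Y min show ?thesis by blast
qed

theorem circuits_splitting_matroid: "circuits M\<^sub>T = \<C>\<^sub>0 \<union> \<C>\<^sub>1 \<union> \<C>\<^sub>2"
  using split_circuit_families C1_family_split_circuit C2_family_split_circuit C0_family_iff
  by blast

section \<open>The element splitting matroid\<close>

context
  fixes z :: 'e
  assumes z: "z \<notin> E"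
begin

abbreviation M\<^sub>z where "M\<^sub>z \<equiv> element_splitting_matroid n A E T z"

lemma ground_element_split [simp]: "ground M\<^sub>z = insert z E"
  by (simp add: element_splitting_matroid_def)

lemma indep_delete_z_iff:
  assumes "X \<subseteq> E"
  shows "X \<in> indeps M\<^sub>z \<longleftrightarrow> X \<in> indeps M\<^sub>T"
proof -
  have sub: "X \<subseteq> insert z E" and zX: "z \<notin> X" using assms z by auto
  have "X \<notin> indeps M\<^sub>z \<longleftrightarrow> X \<notin> indeps M\<^sub>T"
    unfolding element_splitting_matroid_def dependent_vector_matroid_iff[OF sub]
      dependent_split_iff[OF assms]
      lin_relation_element_split_matrix(1)
        [OF finite_subset_E[OF assms] columns_subset[OF assms] zX]
    by (simp only: conj_assoc)
  then show ?thesis by blast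
qed

text \<open>The column of \<open>z\<close> only affects the new row, where its coefficient can absorb any value;
  so the relations on \<open>insert z X\<close> correspond to all the relations on \<open>X\<close>.\<close>

lemma indep_contract_z_iff:
  assumes "X \<subseteq> E"
  shows "insert z X \<in> indeps M\<^sub>z \<longleftrightarrow> X \<in> indeps M"
proof -
  let ?B = "element_split_matrix n A T z"
  have zX: "z \<notin> X" using assms z by auto
  note rel = lin_relation_element_split_matrix(2)
      [OF finite_subset_E[OF assms] columns_subset[OF assms] zX]
  have sub: "insert z X \<subseteq> insert z E" using assms by auto
  have "(\<exists>c. lin_relation (Suc n) ?B (insert z X) c \<and> (\<exists>e \<in> insert z X. c e \<noteq> 0)) \<longleftrightarrow>
        (\<exists>c. lin_relation n A X c \<and> (\<exists>e \<in> X. c e \<noteq> 0))"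
  proof
    assume "\<exists>c. lin_relation (Suc n) ?B (insert z X) c \<and> (\<exists>e \<in> insert z X. c e \<noteq> 0)"
    then obtain c where c: "lin_relation n A X c" "(\<Sum>e \<in> T \<inter> X. c e) + c z = 0"
      "\<exists>e \<in> insert z X. c e \<noteq> 0" unfolding rel by blast
    have "\<exists>e \<in> X. c e \<noteq> 0"
    proof (rule ccontr)
      assume "\<not> (\<exists>e \<in> X. c e \<noteq> 0)"
      with c(2,3) show False by (auto simp: sum.neutral)
    qed
    with c(1) show "\<exists>c. lin_relation n A X c \<and> (\<exists>e \<in> X. c e \<noteq> 0)" by blast
  next
    assume "\<exists>c. lin_relation n A X c \<and> (\<exists>e \<in> X. c e \<noteq> 0)"
    then obtain c where c: "lin_relation n A X c" "\<exists>e \<in> X. c e \<noteq> 0" by blast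
    let ?c = "c(z := - (\<Sum>e \<in> T \<inter> X. c e))"
    have agree: "?c e = c e" if "e \<in> X" for e using that zX by auto
    then have "lin_relation n A X ?c"
      using c(1) finite_subset_E[OF assms] columns_subset[OF assms]
      by (simp add: lin_relation_iff)
    moreover have "(\<Sum>e \<in> T \<inter> X. ?c e) = (\<Sum>e \<in> T \<inter> X. c e)"
      using agree by (intro sum.cong) auto
    ultimately have "lin_relation (Suc n) ?B (insert z X) ?c" unfolding rel by simp
    moreover have "\<exists>e \<in> insert z X. ?c e \<noteq> 0" using c(2) agree by (metis insertCI)
    ultimately show "\<exists>c. lin_relation (Suc n) ?B (insert z X) c \<and> (\<exists>e \<in> insert z X. c e \<noteq> 0)"
      by blast
  qed
  then show ?thesis
    using dependent_vector_matroid_iff[OF sub, of "Suc n" ?B]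
      dependent_vector_matroid_iff[OF assms, of n A]
    unfolding element_splitting_matroid_def by blast
qed

lemma circuits_avoiding_z:
  assumes "X \<subseteq> E"
  shows "X \<in> circuits M\<^sub>z \<longleftrightarrow> X \<in> circuits M\<^sub>T"
proof -
  have "Y \<in> indeps M\<^sub>z \<longleftrightarrow> Y \<in> indeps M\<^sub>T" if "Y \<subseteq> X" for Y
    using that assms indep_delete_z_iff by blast
  with assms show ?thesis unfolding circuits_iff by auto
qed

lemma circuits_through_z:
  assumes "X \<subseteq> E"
  shows "insert z X \<in> circuits M\<^sub>z \<longleftrightarrow> NPT X"
proof -
  have zX: "z \<notin> X" using assms z by auto
  have "insert z X \<in> circuits M\<^sub>z \<longleftrightarrow>
          X \<notin> indeps M \<and> (\<forall>Y. Y \<subset> insert z X \<longrightarrow> Y \<in> indeps M\<^sub>z)"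
    using assms indep_contract_z_iff[OF assms] by (auto simp: circuits_iff)
  also have "(\<forall>Y. Y \<subset> insert z X \<longrightarrow> Y \<in> indeps M\<^sub>z) \<longleftrightarrow>
               X \<in> indeps M\<^sub>T \<and> (\<forall>Y. Y \<subset> X \<longrightarrow> Y \<in> indeps M)" (is "?l \<longleftrightarrow> ?r")
  proof
    assume l: ?l
    have "X \<in> indeps M\<^sub>T" using l zX indep_delete_z_iff[OF assms] by blast
    moreover have "Y \<in> indeps M" if "Y \<subset> X" for Y
    proof -
      have "insert z Y \<subset> insert z X" "Y \<subseteq> E" using that zX assms by auto
      with l show ?thesis using indep_contract_z_iff by blast
    qed
    ultimately show ?r by blast
  next
    assume r: ?r
    show ?l
    proof (intro allI impI)
      fix Y assume Y: "Y \<subset> insert z X"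
      show "Y \<in> indeps M\<^sub>z"
      proof (cases "z \<in> Y")
        case True
        have "Y - {z} \<subset> X" "Y - {z} \<subseteq> E" using Y True assms by auto
        then have "insert z (Y - {z}) \<in> indeps M\<^sub>z" using r indep_contract_z_iff by blast
        with True show ?thesis by (simp add: insert_absorb)
      next
        case False
        then have "Y \<subseteq> X" using Y by blast
        then have "Y \<in> indeps M\<^sub>T" using r dependent_split_mono[of Y X] assms by blast
        with \<open>Y \<subseteq> X\<close> show ?thesis using indep_delete_z_iff[of Y] assms by blast
      qed
    qed
  qed
  finally show ?thesis using assms by (auto simp: NPT_circuit_iff circuits_iff)
qed

theorem circuits_element_splitting_matroid:
  "circuits M\<^sub>z = circuits M\<^sub>T \<union> Cz_family M n A T z"
proof (rule Set.set_eqI)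
  fix X
  show "X \<in> circuits M\<^sub>z \<longleftrightarrow> X \<in> circuits M\<^sub>T \<union> Cz_family M n A T z"
  proof (cases "z \<in> X")
    case False
    then have "X \<notin> Cz_family M n A T z" by (auto simp: Cz_family_def)
    moreover have "X \<in> circuits M\<^sub>z \<Longrightarrow> X \<subseteq> E" using False by (auto simp: circuits_iff)
    ultimately show ?thesis using circuits_avoiding_z circuit_subset_E(2) by blast
  next
    case True
    then have X: "insert z (X - {z}) = X" by blast
    have "X \<notin> circuits M\<^sub>T" using True z circuit_subset_E(2) by blast
    moreover have "X \<in> Cz_family M n A T z \<longleftrightarrow> NPT (X - {z})"
    proof
      assume "X \<in> Cz_family M n A T z"
      then obtain C where C: "X = C \<union> {z}" "NPT C" by (auto simp: Cz_family_def)
      then have "z \<notin> C" using z circuit_subset_E(1) by (auto simp: NPT_circuit_iff)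
      with C show "NPT (X - {z})" by simp
    next
      assume "NPT (X - {z})"
      moreover have "X = (X - {z}) \<union> {z}" using True by auto
      ultimately show "X \<in> Cz_family M n A T z"
        unfolding Cz_family_def by (intro CollectI exI[of _ "X - {z}"] conjI)
    qed
    moreover have "X \<in> circuits M\<^sub>z \<longleftrightarrow> NPT (X - {z})"
    proof (cases "X - {z} \<subseteq> E")
      case True
      with circuits_through_z[OF True] X show ?thesis by simp
    next
      case False
      then have "X \<notin> circuits M\<^sub>z" by (auto simp: circuits_iff)
      with False show ?thesis using circuit_subset_E(1) by (auto simp: NPT_circuit_iff)
    qed
    ultimately show ?thesis by blast
  qed
qed

end

end

theorem theorem3p1:
  fixes M :: "'e indep_system"
    and A :: "'e \<Rightarrow> 'p::prime_card mod_ring vec"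
    and n :: nat
    and E T :: "'e set"
    and z :: 'e
  assumes "matroid M"
    and "ground M = E"
    and "represents n A M"
    and "\<forall>e \<in> E. \<not> loop M e"
    and "\<forall>e \<in> E. \<not> coloop M e"
    and "T \<subseteq> E"
    and "z \<notin> E"
  shows "circuits (splitting_matroid n A E T) =
           C0_family M n A T \<union> C1_family M n A T \<union> C2_family M n A T
       \<and> circuits (element_splitting_matroid n A E T z) =
           C0_family M n A T \<union> C1_family M n A T \<union> C2_family M n A T \<union> Cz_family M n A T z"
proof -
  have M: "M = vector_matroid n A E" and columns: "\<forall>e \<in> E. A e \<in> carrier_vec n"
    using assms(2,3) unfolding represents_def by auto
  have "finite E" using matroid.finite_ground[OF assms(1)] assms(2) by simp
  then interpret labelled_columns n A E T using columns by unfold_locales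
  show ?thesis
    using circuits_splitting_matroid circuits_element_splitting_matroid[OF assms(7)]
    unfolding M by simp
qed

end
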